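(* Let $g_1,\dots,g_m\in\mathbb{R}[x]=\mathbb{R}[x_1,\dots,x_n]$ and assume $S=\{x\in\mathbb{R}^n:\ g_1(x)\ge0,\dots,g_m(x)\ge0\}$ has nonempty interior. If every $g_i$ is sos-concave, then the system $$M_{d_g}(y)\succeq0,\qquad L_{g_1}(y)\ge0,\ \dots,\ L_{g_m}(y)\ge0,\qquad y_0=1$$ in the variables $y=(y_\alpha)_{|\alpha|\le2d_g}$ is a lifted LMI representation of $S$; that is, with $\hat S$ the set of all $y$ satisfying this system, $$S=\{x\in\mathbb{R}^n:\ \exists\,y\in\hat S\text{ with }x_i=y_{e_i},\ 1\le i\le n\}.$$
   Context: A symmetric matrix polynomial $P(x)$ of size $r\times r$ is SOS if $P(x)=W(x)^TW(x)$ for some (possibly nonsquare) matrix polynomial $W(x)$ with $r$ columns. A polynomial $g$ is sos-concave if $-\nabla^2g(x)$ is SOS. $\succeq0$ means positive semidefinite. $d_g=\max_i\lceil\deg(g_i)/2\rceil$. Let $[x^N]$ be the column vector of all monomials in $x$ of degree at most $N$ and write $[x^N][x^N]^T=\sum_{0\le|\alpha|\le2N}A_\alpha x^\alpha$ with constant symmetric matrices $A_\alpha$; the moment matrix is $M_N(y)=\sum_{0\le|\alpha|\le2N}A_\alpha y_\alpha$. If $g_i(x)=\sum_\alpha g^{(i)}_\alpha x^\alpha$ then $L_{g_i}(y)=\sum_\alpha g^{(i)}_\alpha y_\alpha$. $e_i\in\mathbb{N}^n$ is the $i$-th unit vector. $S$ is not assumed compact. *)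

theory Defs
  imports "HOL-Analysis.Analysis" "HOL-Library.Poly_Mapping"
begin

text \<open>
  Exponents \<open>\<alpha> \<in> \<nat>\<^sup>n\<close> are finitely supported maps on a finite type \<open>'n\<close> with
  \<open>CARD('n) = n\<close>, and a polynomial is the finitely supported map sending an exponent to its
  coefficient. The ring structure is the convolution product of \<^theory>\<open>HOL-Library.Poly_Mapping\<close>,
  and the unit vector \<open>e\<^sub>i\<close> is \<open>Poly_Mapping.single i 1\<close>.
\<close>

type_synonym 'n expo = "'n \<Rightarrow>\<^sub>0 nat"
type_synonym 'n mpoly = "'n expo \<Rightarrow>\<^sub>0 real"

definition mdeg :: "'n::finite expo \<Rightarrow> nat" where
  "mdeg \<alpha> = (\<Sum>i\<in>UNIV. Poly_Mapping.lookup \<alpha> i)"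

text \<open>The zero polynomial gets degree \<open>0\<close>.\<close>

definition pdeg :: "'n::finite mpoly \<Rightarrow> nat" where
  "pdeg p = Max (insert 0 (mdeg ` Poly_Mapping.keys p))"

definition peval :: "'n::finite mpoly \<Rightarrow> real ^ 'n \<Rightarrow> real" where
  "peval p x = (\<Sum>\<alpha>\<in>Poly_Mapping.keys p.
     Poly_Mapping.lookup p \<alpha> * (\<Prod>i\<in>UNIV. (x $ i) ^ Poly_Mapping.lookup \<alpha> i))"

text \<open>
  Formal partial derivative; subtraction of exponents truncates, but only where the coefficient
  vanishes. It agrees with the analytic one, see \<open>peval_partial_deriv\<close> below.
\<close>

definition partial_deriv :: "'n::finite \<Rightarrow> 'n mpoly \<Rightarrow> 'n mpoly" where
  "partial_deriv i p =
     (\<Sum>\<alpha>\<in>Poly_Mapping.keys p. Poly_Mapping.single (\<alpha> - Poly_Mapping.single i 1)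
        (real (Poly_Mapping.lookup \<alpha> i) * Poly_Mapping.lookup p \<alpha>))"

definition hessian :: "'n::finite mpoly \<Rightarrow> 'n mpoly ^ 'n ^ 'n" where
  "hessian p = (\<chi> i j. partial_deriv i (partial_deriv j p))"

text \<open>
  \<open>P = W\<^sup>T W\<close>, where \<open>W\<close> has \<open>K\<close> rows \<open>W 0, \<dots>, W (K - 1)\<close>. The rows are numbered by naturals
  rather than by a type because \<open>K\<close> is existentially quantified.
\<close>

definition sos_matrix :: "'n::finite mpoly ^ 'r ^ 'r \<Rightarrow> bool" where
  "sos_matrix P \<longleftrightarrow>
     (\<exists>K (W :: nat \<Rightarrow> 'n mpoly ^ 'r). \<forall>i j. P $ i $ j = (\<Sum>k<K. W k $ i * W k $ j))"

definition sos_concave :: "'n::finite mpoly \<Rightarrow> bool" where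
  "sos_concave g \<longleftrightarrow> sos_matrix (- hessian g)"

definition psd_on :: "'b set \<Rightarrow> ('b \<Rightarrow> 'b \<Rightarrow> real) \<Rightarrow> bool" where
  "psd_on I M \<longleftrightarrow>
     (\<forall>a\<in>I. \<forall>b\<in>I. M a b = M b a) \<and>
     (\<forall>v. 0 \<le> (\<Sum>a\<in>I. \<Sum>b\<in>I. v a * M a b * v b))"

definition expos_upto :: "nat \<Rightarrow> 'n::finite expo set" where
  "expos_upto N = {\<alpha>. mdeg \<alpha> \<le> N}"

definition monomial :: "'n expo \<Rightarrow> 'n mpoly" where
  "monomial \<alpha> = Poly_Mapping.single \<alpha> 1"

text \<open>
  \<open>coeff_matrix \<alpha>\<close> is the coefficient matrix \<open>A\<^sub>\<alpha>\<close> of \<open>x\<^sup>\<alpha>\<close> in \<open>[x\<^sup>N][x\<^sup>N]\<^sup>T\<close>. Its rows and columns are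
  indexed by the exponents of the monomials in \<open>[x\<^sup>N]\<close>, i.e. by \<open>expos_upto N\<close>.
\<close>

definition coeff_matrix :: "'n::finite expo \<Rightarrow> 'n expo \<Rightarrow> 'n expo \<Rightarrow> real" where
  "coeff_matrix \<alpha> \<beta> \<gamma> = Poly_Mapping.lookup (monomial \<beta> * monomial \<gamma>) \<alpha>"

definition moment_matrix ::
  "nat \<Rightarrow> ('n::finite expo \<Rightarrow> real) \<Rightarrow> 'n expo \<Rightarrow> 'n expo \<Rightarrow> real" where
  "moment_matrix N y \<beta> \<gamma> = (\<Sum>\<alpha>\<in>expos_upto (2 * N). coeff_matrix \<alpha> \<beta> \<gamma> * y \<alpha>)"

definition riesz :: "'n::finite mpoly \<Rightarrow> ('n expo \<Rightarrow> real) \<Rightarrow> real" where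
  "riesz g y = (\<Sum>\<alpha>\<in>Poly_Mapping.keys g. Poly_Mapping.lookup g \<alpha> * y \<alpha>)"

definition half_degree :: "nat \<Rightarrow> (nat \<Rightarrow> 'n::finite mpoly) \<Rightarrow> nat" where
  "half_degree m g = Max ((\<lambda>i. nat \<lceil>real (pdeg (g i)) / 2\<rceil>) ` {1..m})"

definition semialg_set :: "nat \<Rightarrow> (nat \<Rightarrow> 'n::finite mpoly) \<Rightarrow> (real ^ 'n) set" where
  "semialg_set m g = {x. \<forall>i\<in>{1..m}. 0 \<le> peval (g i) x}"

text \<open>
  A truncated sequence \<open>(y\<^sub>\<alpha>)\<close>, \<open>|\<alpha>| \<le> 2 d\<close> with \<open>d = half_degree m g\<close>, is a total function on
  exponents; the system does not constrain its values at larger exponents.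
\<close>

definition lifted_set :: "nat \<Rightarrow> (nat \<Rightarrow> 'n::finite mpoly) \<Rightarrow> ('n expo \<Rightarrow> real) set" where
  "lifted_set m g =
     {y. psd_on (expos_upto (half_degree m g)) (moment_matrix (half_degree m g) y) \<and>
         (\<forall>i\<in>{1..m}. 0 \<le> riesz (g i) y) \<and> y 0 = 1}"

lemma finite_expos_upto: "finite (expos_upto N :: 'n::finite expo set)"
proof -
  have "Poly_Mapping.lookup \<alpha> i \<le> N" if "\<alpha> \<in> expos_upto N" for \<alpha> :: "'n expo" and i
  proof -
    have "Poly_Mapping.lookup \<alpha> i \<le> mdeg \<alpha>"
      unfolding mdeg_def by (rule member_le_sum) auto
    with that show ?thesis by (simp add: expos_upto_def)
  qed
  then have "Poly_Mapping.lookup ` (expos_upto N :: 'n expo set) \<subseteq> PiE UNIV (\<lambda>_. {..N})"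
    by auto
  then have "finite (Poly_Mapping.lookup ` (expos_upto N :: 'n expo set))"
    by (rule finite_subset) (auto intro: finite_PiE)
  then show ?thesis
    by (rule finite_imageD) (auto intro: inj_onI poly_mapping_eqI)
qed

lemma moment_matrix_entry:
  assumes "\<beta> \<in> expos_upto N" "\<gamma> \<in> expos_upto N"
  shows "moment_matrix N y \<beta> \<gamma> = y (\<beta> + \<gamma>)"
proof -
  have "\<beta> + \<gamma> \<in> expos_upto (2 * N)"
    using assms by (simp add: expos_upto_def mdeg_def lookup_add sum.distrib)
  then have "(\<Sum>\<alpha>\<in>expos_upto (2 * N). (if \<beta> + \<gamma> = \<alpha> then y \<alpha> else 0)) = y (\<beta> + \<gamma>)"
    by (simp add: finite_expos_upto)
  moreover have "coeff_matrix \<alpha> \<beta> \<gamma> * y \<alpha> = (if \<beta> + \<gamma> = \<alpha> then y \<alpha> else 0)" for \<alpha>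
    by (simp add: coeff_matrix_def monomial_def mult_single lookup_single when_def)
  ultimately show ?thesis by (simp add: moment_matrix_def)
qed

lemma peval_superset:
  assumes "finite A" "Poly_Mapping.keys p \<subseteq> A"
  shows "peval p x = (\<Sum>\<alpha>\<in>A.
    Poly_Mapping.lookup p \<alpha> * (\<Prod>i\<in>UNIV. (x $ i) ^ Poly_Mapping.lookup \<alpha> i))"
  unfolding peval_def
  by (rule sum.mono_neutral_left) (use assms in \<open>auto simp: in_keys_iff\<close>)

lemma peval_single:
  "peval (Poly_Mapping.single \<alpha> c) x = c * (\<Prod>i\<in>UNIV. (x $ i) ^ Poly_Mapping.lookup \<alpha> i)"
  by (subst peval_superset[where A = "{\<alpha>}"]) auto

lemma peval_add: "peval (p + q) x = peval p x + peval q x"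
proof -
  have "Poly_Mapping.keys (p + q) \<subseteq> Poly_Mapping.keys p \<union> Poly_Mapping.keys q" by (rule Poly_Mapping.keys_add)
  then show ?thesis
    by (simp add: peval_superset[where A = "Poly_Mapping.keys p \<union> Poly_Mapping.keys q"] lookup_add
        algebra_simps sum.distrib)
qed

lemma peval_sum: "peval (\<Sum>a\<in>A. f a) x = (\<Sum>a\<in>A. peval (f a) x)"
  by (induction A rule: infinite_finite_induct) (auto simp: peval_add, auto simp: peval_def)

lemma peval_partial_deriv:
  "((\<lambda>t. peval p (x + t *\<^sub>R axis i 1)) has_real_derivative peval (partial_deriv i p) x) (at 0)"
proof -
  have split: "(\<Prod>j\<in>UNIV. (z $ j) ^ Poly_Mapping.lookup \<alpha> j)
      = (z $ i) ^ Poly_Mapping.lookup \<alpha> i * (\<Prod>j\<in>UNIV - {i}. (z $ j) ^ Poly_Mapping.lookup \<alpha> j)"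
    for z and \<alpha> :: "'a expo"
    by (simp add: prod.remove)
  have line: "peval p (x + t *\<^sub>R axis i 1) = (\<Sum>\<alpha>\<in>Poly_Mapping.keys p. Poly_Mapping.lookup p \<alpha> *
      ((x $ i + t) ^ Poly_Mapping.lookup \<alpha> i * (\<Prod>j\<in>UNIV - {i}. (x $ j) ^ Poly_Mapping.lookup \<alpha> j)))" for t
    unfolding peval_def split
    by (intro sum.cong refl arg_cong2[where f = "(*)"] prod.cong) (auto simp: axis_def)
  have "peval (partial_deriv i p) x = (\<Sum>\<alpha>\<in>Poly_Mapping.keys p. Poly_Mapping.lookup p \<alpha> *
      (real (Poly_Mapping.lookup \<alpha> i) * (x $ i) ^ (Poly_Mapping.lookup \<alpha> i - 1) *
        (\<Prod>j\<in>UNIV - {i}. (x $ j) ^ Poly_Mapping.lookup \<alpha> j)))"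
    unfolding partial_deriv_def peval_sum peval_single split
    by (intro sum.cong refl) (simp add: lookup_minus lookup_single when_def)
  then show ?thesis
    unfolding line by (auto intro!: derivative_eq_intros sum.cong)
qed

end

theory Submission
  imports Defs "HOL-Computational_Algebra.Polynomial"
begin

text \<open>
  If \<open>x\<close> satisfies the constraints, take \<open>y\<^sub>\<alpha> = x\<^sup>\<alpha>\<close>. Conversely, one shows Jensen's inequality
  \<open>L\<^sub>g(y) \<le> g(u)\<close> for sos-concave \<open>g\<close>, where \<open>u\<close> is the point of first moments of \<open>y\<close>. Translating,
  we may assume \<open>u = 0\<close>. Then \<open>- x\<^sup>T \<nabla>\<^sup>2g(x) x\<close> is a sum of squares \<open>v\<^sub>k(x)\<^sup>2\<close> and has coefficients
  \<open>- |\<alpha>| (|\<alpha>| - 1) g\<^sub>\<alpha>\<close>, so that \<open>g(0) - L\<^sub>g(y)\<close> is the sum of the integrals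
  \<open>\<integral> (1 - t) L\<^sub>y(v\<^sub>k(t x)\<^sup>2 / t\<^sup>2) dt\<close> over \<open>[0, 1]\<close>. These are nonnegative, because the degree of \<open>v\<^sub>k\<close>
  is at most half that of \<open>g\<close>, rounded up: leading terms of real squares do not cancel.
\<close>

declare One_nat_def [simp del]

text \<open>Stated through the support rather than \<open>pdeg\<close>, so that it serves directly
  as the inclusion required by \<open>riesz_mult\<close> with index set
  \<open>expos_upto N\<close>.\<close>

abbreviation deg_le :: "'n::finite mpoly \<Rightarrow> nat \<Rightarrow> bool" where
  "deg_le p N \<equiv> Poly_Mapping.keys p \<subseteq> expos_upto N"

abbreviation var :: "'n::finite \<Rightarrow> 'n mpoly" where
  "var i \<equiv> monomial (Poly_Mapping.single i 1)"

abbreviation const :: "real \<Rightarrow> 'n::finite mpoly" where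
  "const c \<equiv> Poly_Mapping.single 0 c"

section \<open>Monomials and exponents\<close>

definition mono_eval :: "real ^ 'n \<Rightarrow> 'n::finite expo \<Rightarrow> real" where
  "mono_eval x \<alpha> = (\<Prod>i\<in>UNIV. (x $ i) ^ Poly_Mapping.lookup \<alpha> i)"

lemma mono_eval_0 [simp]: "mono_eval x 0 = 1"
  by (simp add: mono_eval_def)

lemma mono_eval_add: "mono_eval x (\<alpha> + \<beta>) = mono_eval x \<alpha> * mono_eval x \<beta>"
  by (simp add: mono_eval_def lookup_add power_add prod.distrib)

lemma mono_eval_single [simp]: "mono_eval x (Poly_Mapping.single i 1) = x $ i"
proof -
  have "mono_eval x (Poly_Mapping.single i 1) = (\<Prod>j\<in>UNIV. if j = i then x $ i else 1)"
    unfolding mono_eval_def by (rule prod.cong) (auto simp: lookup_single when_def)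
  then show ?thesis by simp
qed

lemma mono_eval_zero: "mono_eval 0 \<alpha> = (if \<alpha> = 0 then 1 else 0)"
proof (cases "\<alpha> = 0")
  case False
  then obtain i where "Poly_Mapping.lookup \<alpha> i \<noteq> 0"
    by (metis lookup_zero poly_mapping_eqI)
  then have "mono_eval 0 \<alpha> = 0"
    unfolding mono_eval_def by (intro prod_zero) (auto intro!: bexI[of _ i])
  with False show ?thesis by simp
qed simp

lemma mono_eval_scaleR: "mono_eval (t *\<^sub>R x) \<alpha> = t ^ mdeg \<alpha> * mono_eval x \<alpha>"
  by (simp add: mono_eval_def mdeg_def power_mult_distrib prod.distrib power_sum)

lemma mdeg_0 [simp]: "mdeg 0 = 0"
  by (simp add: mdeg_def)

lemma mdeg_add: "mdeg (\<alpha> + \<beta>) = mdeg \<alpha> + mdeg \<beta>"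
  by (simp add: mdeg_def lookup_add sum.distrib)

lemma mdeg_single [simp]: "mdeg (Poly_Mapping.single i k) = k"
  by (simp add: mdeg_def lookup_single when_def)

lemma mdeg_eq_0_iff: "mdeg \<alpha> = 0 \<longleftrightarrow> \<alpha> = 0"
  by (auto simp: mdeg_def intro: poly_mapping_eqI)

lemma expo_split:
  fixes \<alpha> :: "'n expo"
  assumes "Poly_Mapping.lookup \<alpha> i > 0"
  shows "\<alpha> - Poly_Mapping.single i 1 + Poly_Mapping.single i 1 = \<alpha>"
  using assms by (intro poly_mapping_eqI) (auto simp: lookup_add lookup_minus lookup_single when_def)

lemma expo_nonzero_cases:
  fixes \<alpha> :: "'n expo"
  assumes "\<alpha> \<noteq> 0"
  obtains i \<beta> where "\<alpha> = \<beta> + Poly_Mapping.single i 1"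
  using assms by (metis expo_split lookup_zero poly_mapping_eqI gr0I)

lemma mdeg_eq_1D:
  assumes "mdeg \<alpha> = 1"
  shows "\<exists>i. \<alpha> = Poly_Mapping.single i 1"
proof -
  have "\<alpha> \<noteq> 0" using assms by auto
  then obtain i \<beta> where *: "\<alpha> = \<beta> + Poly_Mapping.single i 1" by (rule expo_nonzero_cases)
  with assms have "\<beta> = 0" by (simp add: mdeg_add mdeg_eq_0_iff)
  with * show ?thesis by auto
qed

subsection \<open>The Riesz functional\<close>

lemma riesz_superset:
  assumes "finite A" "Poly_Mapping.keys p \<subseteq> A"
  shows "riesz p y = (\<Sum>\<alpha>\<in>A. Poly_Mapping.lookup p \<alpha> * y \<alpha>)"
  unfolding riesz_def
  by (rule sum.mono_neutral_left) (use assms in \<open>auto simp: in_keys_iff\<close>)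

lemma riesz_single: "riesz (Poly_Mapping.single \<alpha> c) y = c * y \<alpha>"
  by (subst riesz_superset[where A = "{\<alpha>}"]) auto

lemma riesz_add: "riesz (p + q) y = riesz p y + riesz q y"
proof -
  have "Poly_Mapping.keys (p + q) \<subseteq> Poly_Mapping.keys p \<union> Poly_Mapping.keys q"
    by (rule Poly_Mapping.keys_add)
  then show ?thesis
    by (simp add: riesz_superset[where A = "Poly_Mapping.keys p \<union> Poly_Mapping.keys q"] lookup_add
        algebra_simps sum.distrib)
qed

lemma riesz_sum: "riesz (\<Sum>a\<in>A. f a) y = (\<Sum>a\<in>A. riesz (f a) y)"
  by (induction A rule: infinite_finite_induct) (auto simp: riesz_add, auto simp: riesz_def)

lemma mpoly_expand:
  fixes p :: "'n::finite mpoly"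
  assumes "finite A" "Poly_Mapping.keys p \<subseteq> A"
  shows "p = (\<Sum>\<alpha>\<in>A. Poly_Mapping.single \<alpha> (Poly_Mapping.lookup p \<alpha>))"
  by (rule poly_mapping_eqI)
    (use assms in \<open>auto simp: lookup_sum lookup_single when_def in_keys_iff\<close>)

text \<open>The index sets are free: \<open>expos_upto d\<close> yields the quadratic form of the
  moment matrix, while the supports themselves suit formal products.\<close>

lemma riesz_mult:
  assumes "finite A" "Poly_Mapping.keys p \<subseteq> A" "finite B" "Poly_Mapping.keys q \<subseteq> B"
  shows "riesz (p * q) y =
    (\<Sum>\<beta>\<in>A. \<Sum>\<gamma>\<in>B. Poly_Mapping.lookup p \<beta> * Poly_Mapping.lookup q \<gamma> * y (\<beta> + \<gamma>))"
proof -
  have "p * q = (\<Sum>\<beta>\<in>A. \<Sum>\<gamma>\<in>B. Poly_Mapping.single (\<beta> + \<gamma>)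
      (Poly_Mapping.lookup p \<beta> * Poly_Mapping.lookup q \<gamma>))"
    by (subst mpoly_expand[OF assms(1,2)], subst mpoly_expand[OF assms(3,4)])
      (simp add: sum_product mult_single)
  then show ?thesis by (simp add: riesz_sum riesz_single)
qed

section \<open>Evaluation, coefficients of derivatives, and equality of polynomials by
  values\<close>

lemma peval_eq_riesz: "peval p x = riesz p (mono_eval x)"
  by (simp add: peval_def riesz_def mono_eval_def)

lemma peval_mult: "peval (p * q) x = peval p x * peval q x"
  unfolding peval_eq_riesz
  by (subst riesz_mult[OF finite_keys order_refl finite_keys order_refl])
    (simp add: riesz_def sum_product mono_eval_add algebra_simps)

lemma peval_const [simp]: "peval (const c) x = c"
  by (simp add: peval_eq_riesz riesz_single)

lemma peval_var [simp]: "peval (var i) x = x $ i"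
  by (simp add: peval_eq_riesz riesz_single monomial_def)

lemma peval_1 [simp]: "peval 1 x = 1"
  using peval_const[of 1 x] by simp

lemma peval_uminus: "peval (- p) x = - peval p x"
  using peval_add[of p "- p" x] by (simp add: peval_def)

lemma peval_power: "peval (p ^ k) x = peval p x ^ k"
  by (induction k) (auto simp: peval_mult)

lemma peval_prod: "peval (\<Prod>a\<in>A. f a) x = (\<Prod>a\<in>A. peval (f a) x)"
  by (induction A rule: infinite_finite_induct) (auto simp: peval_mult)

lemma peval_at_0: "peval p 0 = Poly_Mapping.lookup p 0"
  by (simp add: peval_eq_riesz riesz_def mono_eval_zero in_keys_iff if_distrib cong: if_cong)

text \<open>Truncated subtraction may also send exponents with zero entry at \<open>i\<close> to
  \<open>\<beta>\<close>, but these carry the factor 0. Only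
  \<open>\<beta> + Poly_Mapping.single i 1\<close> contributes.\<close>

lemma lookup_partial_deriv:
  "Poly_Mapping.lookup (partial_deriv i p) \<beta> =
    (real (Poly_Mapping.lookup \<beta> i) + 1) * Poly_Mapping.lookup p (\<beta> + Poly_Mapping.single i 1)"
proof -
  let ?e = "Poly_Mapping.single i 1 :: 'a expo"
  have eq: "(real (Poly_Mapping.lookup \<alpha> i) * Poly_Mapping.lookup p \<alpha> when \<alpha> - ?e = \<beta>) =
      (if \<alpha> = \<beta> + ?e then (real (Poly_Mapping.lookup \<beta> i) + 1) * Poly_Mapping.lookup p \<alpha> else 0)" for \<alpha>
  proof (cases "Poly_Mapping.lookup \<alpha> i = 0")
    case True
    then have "\<alpha> \<noteq> \<beta> + ?e" by (auto simp: lookup_add)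
    with True show ?thesis by simp
  next
    case False
    then have "\<alpha> - ?e + ?e = \<alpha>" by (intro expo_split) simp
    then have "\<alpha> - ?e = \<beta> \<longleftrightarrow> \<alpha> = \<beta> + ?e" by (metis add_diff_cancel_right')
    then show ?thesis by (auto simp: lookup_add)
  qed
  have "Poly_Mapping.lookup (partial_deriv i p) \<beta> =
      (\<Sum>\<alpha>\<in>Poly_Mapping.keys p. if \<alpha> = \<beta> + ?e
        then (real (Poly_Mapping.lookup \<beta> i) + 1) * Poly_Mapping.lookup p \<alpha> else 0)"
    unfolding partial_deriv_def lookup_sum lookup_single eq ..
  then show ?thesis by (simp add: in_keys_iff)
qed

text \<open>Induction on the degree of the exponent: the value at 0 is the constant coefficient, and
  every partial derivative of a vanishing polynomial vanishes too. By
  \<open>lookup_partial_deriv\<close>, the coefficient at \<open>\<alpha>\<close> is a nonzero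
  multiple of one of lower degree in such a derivative.\<close>

lemma peval_eq_0_imp:
  assumes "\<And>x. peval p x = 0"
  shows "p = 0"
proof -
  have "Poly_Mapping.lookup p \<alpha> = 0" if "mdeg \<alpha> = k" "\<And>x. peval p x = 0" for k \<alpha> and p :: "'a mpoly"
    using that
  proof (induction k arbitrary: \<alpha> p)
    case 0
    then show ?case using peval_at_0[of p] by (simp add: mdeg_eq_0_iff)
  next
    case (Suc k)
    then have "\<alpha> \<noteq> 0" by auto
    then obtain i \<beta> where \<alpha>: "\<alpha> = \<beta> + Poly_Mapping.single i 1" by (rule expo_nonzero_cases)
    have "peval (partial_deriv i p) x = 0" for x
      using peval_partial_deriv[of p x i] Suc.prems(2) DERIV_unique[OF _ DERIV_const] by auto
    then have "Poly_Mapping.lookup (partial_deriv i p) \<beta> = 0"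
      using Suc \<alpha> by (simp add: mdeg_add)
    then have "(real (Poly_Mapping.lookup \<beta> i) + 1) * Poly_Mapping.lookup p \<alpha> = 0"
      by (simp only: lookup_partial_deriv \<alpha>)
    moreover have "real (Poly_Mapping.lookup \<beta> i) + 1 \<noteq> 0" by linarith
    ultimately show ?case by simp
  qed
  with assms show ?thesis by (intro poly_mapping_eqI) auto
qed

lemma mpoly_eqI:
  assumes "\<And>x. peval p x = peval q x"
  shows "p = q"
proof -
  have "p + - q = 0"
    by (rule peval_eq_0_imp) (simp only: assms peval_add peval_uminus add.right_inverse)
  then show ?thesis by simp
qed

subsection \<open>Degree bounds\<close>

lemma deg_le_mono: "deg_le p M \<Longrightarrow> M \<le> N \<Longrightarrow> deg_le p N"
  by (auto simp: expos_upto_def)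

lemma deg_le_single: "mdeg \<alpha> \<le> N \<Longrightarrow> deg_le (Poly_Mapping.single \<alpha> c) N"
  by (auto simp: expos_upto_def)

lemma deg_le_add: "deg_le p N \<Longrightarrow> deg_le q N \<Longrightarrow> deg_le (p + q) N"
  using Poly_Mapping.keys_add[of p q] by blast

lemma deg_le_sum: "(\<And>a. a \<in> A \<Longrightarrow> deg_le (f a) N) \<Longrightarrow> deg_le (\<Sum>a\<in>A. f a) N"
  by (induction A rule: infinite_finite_induct) (simp_all add: deg_le_add)

lemma deg_le_mult:
  assumes "deg_le p M" "deg_le q N"
  shows "deg_le (p * q) (M + N)"
proof
  fix \<alpha> assume "\<alpha> \<in> Poly_Mapping.keys (p * q)"
  then obtain \<beta> \<gamma> where "\<alpha> = \<beta> + \<gamma>" "\<beta> \<in> Poly_Mapping.keys p" "\<gamma> \<in> Poly_Mapping.keys q"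
    using keys_mult[of p q] by blast
  with assms show "\<alpha> \<in> expos_upto (M + N)"
    by (auto simp: expos_upto_def mdeg_add intro!: add_mono)
qed

lemma deg_le_power: "deg_le p N \<Longrightarrow> deg_le (p ^ k) (k * N)"
proof (induction k)
  case 0
  then show ?case using deg_le_single[of 0 0 1] by simp
next
  case (Suc k)
  then show ?case using deg_le_mult[of p N "p ^ k" "k * N"] by simp
qed

lemma deg_le_prod:
  "(\<And>a. a \<in> A \<Longrightarrow> deg_le (f a) (N a)) \<Longrightarrow> deg_le (\<Prod>a\<in>A. f a) (\<Sum>a\<in>A. N a)"
proof (induction A rule: infinite_finite_induct)
  case (insert a A)
  then show ?case by (simp add: deg_le_mult)
qed (use deg_le_single[of 0 0 1] in auto)

lemma deg_le_partial_deriv: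
  assumes "deg_le p (Suc N)"
  shows "deg_le (partial_deriv i p) N"
proof
  fix \<beta> assume "\<beta> \<in> Poly_Mapping.keys (partial_deriv i p)"
  then have "\<beta> + Poly_Mapping.single i 1 \<in> Poly_Mapping.keys p"
    by (auto simp: in_keys_iff lookup_partial_deriv)
  with assms have "\<beta> + Poly_Mapping.single i 1 \<in> expos_upto (Suc N)" by blast
  then show "\<beta> \<in> expos_upto N" by (simp add: expos_upto_def mdeg_add)
qed

lemma pdeg_le_imp_deg_le:
  assumes "pdeg p \<le> N"
  shows "deg_le p N"
  using assms unfolding pdeg_def expos_upto_def by (auto simp: Max_le_iff)

text \<open>The restriction of \<open>p\<close> to the line through 0 and \<open>x\<close>, in the
  scaling factor. Its coefficient in degree k is the value at \<open>x\<close> of the homogeneous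
  part of degree k, which reduces degree questions to one variable.\<close>

definition ray :: "real ^ 'n \<Rightarrow> 'n::finite mpoly \<Rightarrow> real poly" where
  "ray x p = (\<Sum>\<alpha>\<in>Poly_Mapping.keys p.
     Polynomial.monom (Poly_Mapping.lookup p \<alpha> * mono_eval x \<alpha>) (mdeg \<alpha>))"

lemma poly_ray: "poly (ray x p) t = peval p (t *\<^sub>R x)"
  by (simp add: ray_def poly_sum poly_monom peval_eq_riesz riesz_def mono_eval_scaleR algebra_simps)

lemma degree_ray_le:
  assumes "deg_le p N"
  shows "degree (ray x p) \<le> N"
  unfolding ray_def
proof (rule degree_sum_le)
  fix \<alpha> assume "\<alpha> \<in> Poly_Mapping.keys p"
  with assms have "mdeg \<alpha> \<le> N" by (auto simp: expos_upto_def)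
  then show "degree (Polynomial.monom (Poly_Mapping.lookup p \<alpha> * mono_eval x \<alpha>) (mdeg \<alpha>)) \<le> N"
    using degree_monom_le order_trans by blast
qed simp

lemma deg_le_if_degree_ray_le:
  assumes "\<And>x. degree (ray x p) \<le> N"
  shows "deg_le p N"
proof
  fix \<alpha> assume \<alpha>: "\<alpha> \<in> Poly_Mapping.keys p"
  show "\<alpha> \<in> expos_upto N"
  proof (rule ccontr)
    assume "\<alpha> \<notin> expos_upto N"
    then have gt: "mdeg \<alpha> > N" by (simp add: expos_upto_def)
    \<comment> \<open>The homogeneous part of \<open>p\<close> containing \<open>\<alpha>\<close>.
      Its values are coefficients of rays beyond their degree, so it vanishes, although its
      coefficient at \<open>\<alpha>\<close> does not.\<close>
    define q where "q = (\<Sum>\<beta>\<in>Poly_Mapping.keys p. if mdeg \<beta> = mdeg \<alpha>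
      then Poly_Mapping.single \<beta> (Poly_Mapping.lookup p \<beta>) else 0)"
    have "peval q x = coeff (ray x p) (mdeg \<alpha>)" for x
      unfolding q_def ray_def peval_sum coeff_sum
      by (intro sum.cong refl) (auto simp: peval_single mono_eval_def peval_def)
    also have "coeff (ray x p) (mdeg \<alpha>) = 0" for x
      using assms[of x] gt by (intro coeff_eq_0) simp
    finally have "q = 0" by (rule peval_eq_0_imp)
    moreover have "Poly_Mapping.lookup q \<alpha> = (\<Sum>\<beta>\<in>Poly_Mapping.keys p.
        if \<beta> = \<alpha> then Poly_Mapping.lookup p \<alpha> else 0)"
      unfolding q_def lookup_sum by (intro sum.cong refl) (auto simp: lookup_single when_def)
    ultimately show False using \<alpha> by (simp add: in_keys_iff)
  qed
qed

text \<open>Leading coefficients of real squares cannot cancel.\<close>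

lemma degree_le_if_degree_sum_squares_le:
  fixes P :: "nat \<Rightarrow> real poly"
  assumes "degree (\<Sum>k<K. P k * P k) \<le> 2 * e" "k < K"
  shows "degree (P k) \<le> e"
proof -
  define N where "N = Max ((\<lambda>k. degree (P k)) ` {..<K})"
  have le: "degree (P j) \<le> N" if "j < K" for j
    unfolding N_def using that by (intro Max_ge) auto
  have "N \<in> (\<lambda>k. degree (P k)) ` {..<K}"
    unfolding N_def using assms(2) by (intro Max_in) auto
  then obtain j where j: "j < K" "degree (P j) = N" by auto
  have "N \<le> e"
  proof (rule ccontr)
    assume "\<not> N \<le> e"
    then have "coeff (\<Sum>k<K. P k * P k) (N + N) = 0"
      using assms(1) by (intro coeff_eq_0) simp
    \<comment> \<open>Summands of degree below \<open>N\<close> contribute 0 on both sides, so the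
      coefficient of the sum is a sum of real squares.\<close>
    moreover have "coeff (P k * P k) (N + N) = (coeff (P k) N)\<^sup>2" if "k < K" for k
    proof (cases "degree (P k) = N")
      case True
      then show ?thesis using coeff_mult_degree_sum[of "P k" "P k"] by (simp add: power2_eq_square)
    next
      case False
      then have "degree (P k) < N" using le[OF that] by simp
      moreover have "degree (P k * P k) < N + N"
        using degree_mult_le[of "P k" "P k"] calculation by simp
      ultimately show ?thesis by (simp add: coeff_eq_0)
    qed
    ultimately have "(\<Sum>k<K. (coeff (P k) N)\<^sup>2) = 0" by (simp add: coeff_sum)
    then have "coeff (P j) N = 0" using j(1) by (simp add: sum_nonneg_eq_0_iff)
    \<comment> \<open>The coefficient at \<open>N\<close> is the leading one of \<open>P j\<close>;
      hence \<open>P j = 0\<close> and \<open>N = 0\<close>, against \<open>N > e\<close>.\<close>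
    then have "P j = 0" using j(2) by auto
    then show False using j(2) \<open>\<not> N \<le> e\<close> by simp
  qed
  with le[OF assms(2)] show ?thesis by simp
qed

text \<open>Restriction to a ray respects sums and products, so the univariate bound applies on
  every ray.\<close>

lemma deg_le_if_sum_squares:
  fixes p :: "nat \<Rightarrow> 'n::finite mpoly"
  assumes "deg_le (\<Sum>k<K. p k * p k) (2 * e)" "k < K"
  shows "deg_le (p k) e"
proof (rule deg_le_if_degree_ray_le)
  fix x
  have "ray x (\<Sum>k<K. p k * p k) = (\<Sum>k<K. ray x (p k) * ray x (p k))"
    by (subst poly_eq_poly_eq_iff[symmetric], rule ext)
      (simp add: poly_sum poly_ray peval_sum peval_mult)
  then show "degree (ray x (p k)) \<le> e"
    using degree_ray_le[OF assms(1), of x] assms(2)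
      degree_le_if_degree_sum_squares_le[of "\<lambda>k. ray x (p k)"] by simp
qed

subsection \<open>Jensen's inequality at the origin\<close>

lemma lookup_var_mult:
  "Poly_Mapping.lookup (var i * p) \<alpha> =
    (if Poly_Mapping.lookup \<alpha> i = 0 then 0 else Poly_Mapping.lookup p (\<alpha> - Poly_Mapping.single i 1))"
proof -
  let ?e = "Poly_Mapping.single i 1 :: 'a expo"
  have eq: "?e + \<beta> = \<alpha> \<longleftrightarrow> Poly_Mapping.lookup \<alpha> i \<noteq> 0 \<and> \<beta> = \<alpha> - ?e" for \<beta>
  proof
    assume *: "?e + \<beta> = \<alpha>"
    then have "Poly_Mapping.lookup \<alpha> i \<noteq> 0" by (auto simp: lookup_add)
    moreover have "\<beta> = \<alpha> - ?e" using * by (metis add_diff_cancel_left')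
    ultimately show "Poly_Mapping.lookup \<alpha> i \<noteq> 0 \<and> \<beta> = \<alpha> - ?e" ..
  next
    assume "Poly_Mapping.lookup \<alpha> i \<noteq> 0 \<and> \<beta> = \<alpha> - ?e"
    then show "?e + \<beta> = \<alpha>" using expo_split[of \<alpha> i] by (simp add: add.commute)
  qed
  have "var i * p = (\<Sum>\<beta>\<in>Poly_Mapping.keys p.
      Poly_Mapping.single (?e + \<beta>) (Poly_Mapping.lookup p \<beta>))"
    by (subst mpoly_expand[OF finite_keys order_refl])
      (simp add: sum_distrib_left mult_single monomial_def)
  then have "Poly_Mapping.lookup (var i * p) \<alpha> = (\<Sum>\<beta>\<in>Poly_Mapping.keys p.
      if \<beta> = \<alpha> - ?e then (if Poly_Mapping.lookup \<alpha> i = 0 then 0 else Poly_Mapping.lookup p \<beta>) else 0)"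
    by (simp only: lookup_sum lookup_single eq when_def) (intro sum.cong, auto)
  then show ?thesis by (simp add: in_keys_iff)
qed

text \<open>Euler's identity: multiplying the \<open>i\<close>-th derivative by the
  \<open>i\<close>-th variable scales each monomial by its \<open>i\<close>-th exponent.\<close>

lemma lookup_euler:
  "Poly_Mapping.lookup (\<Sum>i\<in>UNIV. var i * partial_deriv i p) \<alpha> =
    real (mdeg \<alpha>) * Poly_Mapping.lookup p \<alpha>"
proof -
  have "Poly_Mapping.lookup (var i * partial_deriv i p) \<alpha> =
      real (Poly_Mapping.lookup \<alpha> i) * Poly_Mapping.lookup p \<alpha>" for i
  proof (cases "Poly_Mapping.lookup \<alpha> i = 0")
    case False
    then have "\<alpha> - Poly_Mapping.single i 1 + Poly_Mapping.single i 1 = \<alpha>"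
      by (intro expo_split) simp
    with False show ?thesis
      by (simp add: lookup_var_mult lookup_partial_deriv lookup_minus)
  qed (simp add: lookup_var_mult)
  then show ?thesis by (simp add: lookup_sum mdeg_def sum_distrib_right)
qed

text \<open>The inner sum is Euler's operator on the \<open>j\<close>-th derivative, where the
  relevant exponent has degree one less; this gives the factor \<open>mdeg \<alpha> - 1\<close>. The
  outer sum contributes \<open>mdeg \<alpha>\<close>.\<close>

lemma lookup_hessian_form:
  "Poly_Mapping.lookup (\<Sum>i\<in>UNIV. \<Sum>j\<in>UNIV. var i * var j * hessian p $ i $ j) \<alpha> =
    real (mdeg \<alpha>) * (real (mdeg \<alpha>) - 1) * Poly_Mapping.lookup p \<alpha>"
proof -
  have eq: "(\<Sum>i\<in>UNIV. \<Sum>j\<in>UNIV. var i * var j * hessian p $ i $ j) =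
      (\<Sum>j\<in>UNIV. var j * (\<Sum>i\<in>UNIV. var i * partial_deriv i (partial_deriv j p)))"
    by (subst sum.swap) (simp add: hessian_def sum_distrib_left mult_ac)
  have "Poly_Mapping.lookup (var j * (\<Sum>i\<in>UNIV. var i * partial_deriv i (partial_deriv j p))) \<alpha> =
      real (Poly_Mapping.lookup \<alpha> j) * (real (mdeg \<alpha>) - 1) * Poly_Mapping.lookup p \<alpha>" for j
  proof (cases "Poly_Mapping.lookup \<alpha> j = 0")
    case False
    then have *: "\<alpha> - Poly_Mapping.single j 1 + Poly_Mapping.single j 1 = \<alpha>"
      by (intro expo_split) simp
    then have "mdeg (\<alpha> - Poly_Mapping.single j 1) + 1 = mdeg \<alpha>"
      by (metis mdeg_add mdeg_single)
    then have "real (mdeg (\<alpha> - Poly_Mapping.single j 1)) = real (mdeg \<alpha>) - 1" by linarith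
    with False * show ?thesis
      by (simp add: lookup_var_mult lookup_euler) (simp add: lookup_partial_deriv lookup_minus)
  qed (simp add: lookup_var_mult)
  then show ?thesis by (simp add: eq lookup_sum mdeg_def sum_distrib_right)
qed

text \<open>The kernel \<open>1 - t\<close> is that of the second-order Taylor remainder. For
  \<open>n = mdeg \<alpha> - 2\<close> the value is the reciprocal of the factor in
  \<open>lookup_hessian_form\<close>.\<close>

lemma moment_weight_integral:
  "((\<lambda>t::real. (1 - t) * t ^ n) has_integral 1 / ((real n + 1) * (real n + 2))) {0..1}"
proof -
  let ?F = "\<lambda>t::real. t ^ Suc n / real (Suc n) - t ^ Suc (Suc n) / real (Suc (Suc n))"
  have "(?F has_real_derivative (1 - t) * t ^ n) (at t within {0..1})" for t :: real
    by (rule derivative_eq_intros refl | simp add: algebra_simps del: of_nat_Suc)+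
  then have "((\<lambda>t::real. (1 - t) * t ^ n) has_integral ?F 1 - ?F 0) {0..1}"
    by (intro fundamental_theorem_of_calculus)
      (auto simp: has_real_derivative_iff_has_vector_derivative)
  also have "?F 1 - ?F 0 = 1 / ((real n + 1) * (real n + 2))"
    by (simp add: field_simps)
  finally show ?thesis .
qed

text \<open>
  The weight \<open>1 / (|\<alpha>| (|\<alpha>| - 1))\<close> inverts the factor of \<open>lookup_hessian_form\<close>. For \<open>|\<alpha>| \<le> 1\<close> it
  is \<open>1 / 0 = 0\<close>.
\<close>

definition hess_weight :: "'n::finite expo \<Rightarrow> real" where
  "hess_weight \<alpha> = 1 / (real (mdeg \<alpha>) * (real (mdeg \<alpha>) - 1))"

text \<open>
  The weighted value is \<open>\<integral> (1 - t) L\<^sub>y(v(t x)\<^sup>2 / t\<^sup>2) dt\<close> over \<open>[0, 1]\<close>, where \<open>v(t x) / t\<close> is a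
  polynomial in \<open>x\<close> because \<open>v\<close> has no constant term.
\<close>

lemma riesz_weighted_square_nonneg:
  assumes psd: "\<And>p. deg_le p d \<Longrightarrow> 0 \<le> riesz (p * p) y"
    and v: "deg_le v d" "Poly_Mapping.lookup v 0 = 0"
  shows "0 \<le> riesz (v * v) (\<lambda>\<alpha>. hess_weight \<alpha> * y \<alpha>)"
proof -
  let ?K = "Poly_Mapping.keys v"
  define f where "f t = (\<Sum>\<beta>\<in>?K. \<Sum>\<gamma>\<in>?K. ((1 - t) * t ^ (mdeg \<beta> + mdeg \<gamma> - 2)) *
    (Poly_Mapping.lookup v \<beta> * Poly_Mapping.lookup v \<gamma> * y (\<beta> + \<gamma>)))" for t :: real
  \<comment> \<open>Ensures that the natural subtractions in the exponents of \<open>t\<close> do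
    not truncate.\<close>
  have deg: "mdeg \<beta> \<ge> 1" if "\<beta> \<in> ?K" for \<beta>
    using that v(2) mdeg_eq_0_iff[of \<beta>] by (cases "\<beta> = 0") (auto simp: in_keys_iff)
  have weight: "hess_weight (\<beta> + \<gamma>) =
      1 / ((real (mdeg \<beta> + mdeg \<gamma> - 2) + 1) * (real (mdeg \<beta> + mdeg \<gamma> - 2) + 2))"
    if "\<beta> \<in> ?K" "\<gamma> \<in> ?K" for \<beta> \<gamma>
    using deg[OF that(1)] deg[OF that(2)]
    by (simp add: hess_weight_def mdeg_add of_nat_diff algebra_simps)
  have "(f has_integral (\<Sum>\<beta>\<in>?K. \<Sum>\<gamma>\<in>?K. hess_weight (\<beta> + \<gamma>) *
      (Poly_Mapping.lookup v \<beta> * Poly_Mapping.lookup v \<gamma> * y (\<beta> + \<gamma>)))) {0..1}"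
    unfolding f_def
    by (intro has_integral_sum has_integral_mult_left finite_keys)
      (simp only: weight moment_weight_integral)
  moreover have "0 \<le> f t" if t: "t \<in> {0..1}" for t
  proof -
    \<comment> \<open>This is \<open>v(t x) / t\<close> written by coefficients, so that it makes
      sense at \<open>t = 0\<close> as well.\<close>
    define w where "w = (\<Sum>\<beta>\<in>?K. Poly_Mapping.single \<beta>
      (t ^ (mdeg \<beta> - 1) * Poly_Mapping.lookup v \<beta>))"
    have w: "Poly_Mapping.lookup w \<beta> = t ^ (mdeg \<beta> - 1) * Poly_Mapping.lookup v \<beta>" for \<beta>
      unfolding w_def by (auto simp: lookup_sum lookup_single when_def in_keys_iff)
    then have keys: "Poly_Mapping.keys w \<subseteq> ?K"
      by (auto simp: in_keys_iff)
    have "riesz (w * w) y = (\<Sum>\<beta>\<in>?K. \<Sum>\<gamma>\<in>?K. t ^ (mdeg \<beta> + mdeg \<gamma> - 2) *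
        (Poly_Mapping.lookup v \<beta> * Poly_Mapping.lookup v \<gamma> * y (\<beta> + \<gamma>)))"
      unfolding riesz_mult[OF finite_keys keys finite_keys keys]
    proof (intro sum.cong refl)
      fix \<beta> \<gamma> assume "\<beta> \<in> ?K" "\<gamma> \<in> ?K"
      then have "mdeg \<beta> + mdeg \<gamma> - 2 = (mdeg \<beta> - 1) + (mdeg \<gamma> - 1)"
        using deg by fastforce
      then show "Poly_Mapping.lookup w \<beta> * Poly_Mapping.lookup w \<gamma> * y (\<beta> + \<gamma>) =
          t ^ (mdeg \<beta> + mdeg \<gamma> - 2) *
            (Poly_Mapping.lookup v \<beta> * Poly_Mapping.lookup v \<gamma> * y (\<beta> + \<gamma>))"
        by (simp add: w power_add)
    qed
    then have "f t = (1 - t) * riesz (w * w) y"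
      by (simp add: f_def sum_distrib_left mult.assoc)
    moreover have "0 \<le> riesz (w * w) y"
      using keys v(1) by (intro psd) blast
    ultimately show ?thesis using t by simp
  qed
  ultimately have "0 \<le> (\<Sum>\<beta>\<in>?K. \<Sum>\<gamma>\<in>?K. hess_weight (\<beta> + \<gamma>) *
      (Poly_Mapping.lookup v \<beta> * Poly_Mapping.lookup v \<gamma> * y (\<beta> + \<gamma>)))"
    by (rule has_integral_nonneg)
  also have "\<dots> = riesz (v * v) (\<lambda>\<alpha>. hess_weight \<alpha> * y \<alpha>)"
    by (simp add: riesz_mult[OF finite_keys order_refl finite_keys order_refl] mult_ac)
  finally show ?thesis .
qed

text \<open>As the first moments vanish, the two sides differ only by terms of degree at least 2.
  There \<open>hess_weight\<close> undoes the Hessian form, so the difference is the weighted Riesz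
  value of a sum of squares.\<close>

lemma riesz_le_at_0:
  fixes h :: "'n::finite mpoly"
  assumes "sos_concave h" and h: "deg_le h (2 * d)"
    and psd: "\<And>p. deg_le p d \<Longrightarrow> 0 \<le> riesz (p * p) y"
    and y: "\<And>i. y (Poly_Mapping.single i 1) = 0"
  shows "riesz h y \<le> Poly_Mapping.lookup h 0 * y 0"
proof (cases d)
  case 0
  then have "Poly_Mapping.keys h \<subseteq> {0}"
    using h by (auto simp: expos_upto_def mdeg_eq_0_iff)
  then show ?thesis by (simp add: riesz_superset[of "{0}"])
next
  case (Suc e)
  obtain K and W :: "nat \<Rightarrow> 'n mpoly ^ 'n"
    where W: "\<And>i j. (- hessian h) $ i $ j = (\<Sum>k<K. W k $ i * W k $ j)"
    using assms(1) unfolding sos_concave_def sos_matrix_def by blast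
  \<comment> \<open>The entries of \<open>W(x) x\<close>, so that \<open>E\<close> is its squared
    norm.\<close>
  define v where "v k = (\<Sum>i\<in>UNIV. var i * W k $ i)" for k :: nat
  define E where "E = (\<Sum>k<K. v k * v k)"
  have "E = - (\<Sum>i\<in>UNIV. \<Sum>j\<in>UNIV. var i * var j * hessian h $ i $ j)"
  proof -
    have "E = (\<Sum>i\<in>UNIV. \<Sum>j\<in>UNIV. \<Sum>k<K. var i * var j * (W k $ i * W k $ j))"
      unfolding E_def v_def sum_product
      by (subst sum.swap, intro sum.cong refl, subst sum.swap) (simp add: mult_ac)
    also have "\<dots> = (\<Sum>i\<in>UNIV. \<Sum>j\<in>UNIV. var i * var j * (- hessian h) $ i $ j)"
      by (simp only: W sum_distrib_left)
    finally show ?thesis by (simp add: sum_negf)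
  qed
  then have lookup_E: "Poly_Mapping.lookup E \<alpha> =
      - (real (mdeg \<alpha>) * (real (mdeg \<alpha>) - 1) * Poly_Mapping.lookup h \<alpha>)" for \<alpha>
    by (simp only: uminus_poly_mapping.rep_eq fun_Compl_def lookup_hessian_form)
  have "0 \<le> riesz (v k * v k) (\<lambda>\<alpha>. hess_weight \<alpha> * y \<alpha>)" if k: "k < K" for k
  proof (rule riesz_weighted_square_nonneg[OF psd])
    \<comment> \<open>Each diagonal Hessian entry is, up to sign, a sum of squares over one column
      of \<open>W\<close>. Its degree is at most \<open>2 * d - 2 = 2 * e\<close>.\<close>
    have "deg_le (W k $ i) e" for i
    proof (rule deg_le_if_sum_squares[OF _ k])
      have "deg_le (hessian h $ i $ i) (2 * e)"
        using h Suc by (simp add: hessian_def deg_le_partial_deriv)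
      moreover have "(\<Sum>k<K. W k $ i * W k $ i) = - (hessian h $ i $ i)"
        using W[of i i] by simp
      ultimately show "deg_le (\<Sum>k<K. W k $ i * W k $ i) (2 * e)"
        by simp
    qed
    then have "deg_le (var i * W k $ i) (Suc e)" for i
      unfolding Suc_eq_plus1_left
      by (intro deg_le_mult) (auto simp: monomial_def expos_upto_def)
    then show "deg_le (v k) d" unfolding v_def Suc by (intro deg_le_sum) simp_all
    show "Poly_Mapping.lookup (v k) 0 = 0"
      unfolding v_def lookup_sum lookup_var_mult by simp
  qed
  then have "0 \<le> riesz E (\<lambda>\<alpha>. hess_weight \<alpha> * y \<alpha>)"
    unfolding E_def riesz_sum by (intro sum_nonneg) auto
  moreover have "riesz h y + riesz E (\<lambda>\<alpha>. hess_weight \<alpha> * y \<alpha>) = Poly_Mapping.lookup h 0 * y 0"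
  proof -
    have keys: "Poly_Mapping.keys E \<subseteq> Poly_Mapping.keys h"
      by (auto simp: in_keys_iff lookup_E)
    have "riesz h y + riesz E (\<lambda>\<alpha>. hess_weight \<alpha> * y \<alpha>) = (\<Sum>\<alpha>\<in>Poly_Mapping.keys h.
        Poly_Mapping.lookup h \<alpha> * y \<alpha> + Poly_Mapping.lookup E \<alpha> * (hess_weight \<alpha> * y \<alpha>))"
      by (simp add: riesz_superset[OF finite_keys keys] riesz_def[of h] sum.distrib)
    also have "\<dots> = (\<Sum>\<alpha>\<in>Poly_Mapping.keys h.
        if \<alpha> = 0 then Poly_Mapping.lookup h 0 * y 0 else 0)"
    proof (intro sum.cong refl)
      fix \<alpha> :: "'n expo"
      \<comment> \<open>In degree 0 the coefficient of \<open>E\<close> vanishes, in degree 1 the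
        moment does, and from degree 2 on the two terms cancel.\<close>
      consider "\<alpha> = 0" | "mdeg \<alpha> = 1" | "mdeg \<alpha> \<ge> 2"
        using mdeg_eq_0_iff[of \<alpha>] by linarith
      then show "Poly_Mapping.lookup h \<alpha> * y \<alpha> + Poly_Mapping.lookup E \<alpha> * (hess_weight \<alpha> * y \<alpha>) =
          (if \<alpha> = 0 then Poly_Mapping.lookup h 0 * y 0 else 0)"
      proof cases
        case 2
        then have "y \<alpha> = 0" "\<alpha> \<noteq> 0" using mdeg_eq_1D[OF 2] y by auto
        then show ?thesis by simp
      next
        case 3
        then have "\<alpha> \<noteq> 0" "real (mdeg \<alpha>) \<noteq> 0" "real (mdeg \<alpha>) - 1 \<noteq> 0" by auto
        then show ?thesis by (simp add: lookup_E hess_weight_def)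
      qed (simp add: lookup_E)
    qed
    finally show ?thesis by (simp add: in_keys_iff)
  qed
  ultimately show ?thesis by linarith
qed

subsection \<open>Translation to an arbitrary point\<close>

text \<open>Formal substitution of \<open>x + u\<close>. Its algebraic laws follow from
  \<open>peval_shift\<close>, since values determine polynomials.\<close>

definition shift :: "real ^ 'n \<Rightarrow> 'n::finite mpoly \<Rightarrow> 'n mpoly" where
  "shift u p = (\<Sum>\<alpha>\<in>Poly_Mapping.keys p. const (Poly_Mapping.lookup p \<alpha>) *
     (\<Prod>i\<in>UNIV. (var i + const (u $ i)) ^ Poly_Mapping.lookup \<alpha> i))"

lemma peval_shift [simp]: "peval (shift u p) x = peval p (x + u)"
  by (simp add: shift_def peval_sum peval_mult peval_prod peval_power peval_add)
    (simp add: peval_def)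

lemma shift_mult: "shift u (p * q) = shift u p * shift u q"
  by (rule mpoly_eqI) (simp add: peval_mult)

lemma shift_uminus: "shift u (- p) = - shift u p"
  by (rule mpoly_eqI) (simp add: peval_uminus)

lemma shift_sum: "shift u (\<Sum>a\<in>A. f a) = (\<Sum>a\<in>A. shift u (f a))"
  by (rule mpoly_eqI) (simp add: peval_sum)

lemma shift_shift: "shift (- u) (shift u p) = p"
  by (rule mpoly_eqI) simp

text \<open>Both sides evaluate to the derivative of the same function along the \<open>i\<close>-th
  axis.\<close>

lemma shift_partial_deriv: "shift u (partial_deriv i p) = partial_deriv i (shift u p)"
proof (rule mpoly_eqI)
  fix x
  have "((\<lambda>t. peval (shift u p) (x + t *\<^sub>R axis i 1)) has_real_derivative
      peval (partial_deriv i p) (x + u)) (at 0)"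
    using peval_partial_deriv[of p "x + u" i] by (simp add: algebra_simps)
  from DERIV_unique[OF this peval_partial_deriv]
  show "peval (shift u (partial_deriv i p)) x = peval (partial_deriv i (shift u p)) x"
    by (simp only: peval_shift)
qed

lemma deg_le_shift:
  assumes "deg_le p N"
  shows "deg_le (shift u p) N"
  unfolding shift_def
proof (rule deg_le_sum)
  fix \<alpha> assume "\<alpha> \<in> Poly_Mapping.keys p"
  with assms have \<alpha>: "mdeg \<alpha> \<le> N" by (auto simp: expos_upto_def)
  have "deg_le (var i + const (u $ i)) 1" for i
    by (intro deg_le_add) (auto simp: monomial_def expos_upto_def)
  then have "deg_le (\<Prod>i\<in>UNIV. (var i + const (u $ i)) ^ Poly_Mapping.lookup \<alpha> i)
      (\<Sum>i\<in>UNIV. Poly_Mapping.lookup \<alpha> i * 1)"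
    by (intro deg_le_prod deg_le_power)
  then have prod: "deg_le (\<Prod>i\<in>UNIV. (var i + const (u $ i)) ^ Poly_Mapping.lookup \<alpha> i) N"
    by (rule deg_le_mono) (use \<alpha> in \<open>simp add: mdeg_def\<close>)
  have "deg_le (const (Poly_Mapping.lookup p \<alpha>) :: 'a mpoly) 0"
    by (rule deg_le_single) simp
  from deg_le_mult[OF this prod] show "deg_le (const (Poly_Mapping.lookup p \<alpha>) *
      (\<Prod>i\<in>UNIV. (var i + const (u $ i)) ^ Poly_Mapping.lookup \<alpha> i)) N"
    by (simp only: add_0)
qed

text \<open>Translation respects sums and products and commutes with differentiation, so translating
  the entries of \<open>W\<close> gives a certificate for the translated Hessian.\<close>

lemma sos_concave_shift:
  fixes p :: "'n::finite mpoly"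
  assumes "sos_concave p"
  shows "sos_concave (shift u p)"
proof -
  obtain K and W :: "nat \<Rightarrow> 'n mpoly ^ 'n"
    where W: "\<And>i j. (- hessian p) $ i $ j = (\<Sum>k<K. W k $ i * W k $ j)"
    using assms unfolding sos_concave_def sos_matrix_def by blast
  have "(- hessian (shift u p)) $ i $ j = shift u ((- hessian p) $ i $ j)" for i j
    by (simp add: hessian_def shift_partial_deriv shift_uminus)
  then have "(- hessian (shift u p)) $ i $ j =
      (\<Sum>k<K. (\<chi> i. shift u (W k $ i)) $ i * (\<chi> i. shift u (W k $ i)) $ j)" for i j
    by (simp only: W shift_sum shift_mult vec_lambda_beta)
  then show ?thesis
    unfolding sos_concave_def sos_matrix_def
    by (intro exI[of _ K] exI[of _ "\<lambda>k. \<chi> i. shift u (W k $ i)"]) blast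
qed

lemma riesz_shift:
  "riesz (shift u p) y = riesz p (\<lambda>\<alpha>. riesz (shift u (monomial \<alpha>)) y)"
proof -
  have "shift u p = (\<Sum>\<alpha>\<in>Poly_Mapping.keys p.
      const (Poly_Mapping.lookup p \<alpha>) * shift u (monomial \<alpha>))"
    by (rule mpoly_eqI)
      (simp add: peval_sum peval_mult monomial_def peval_single, simp add: peval_def)
  moreover have "riesz (const c * q) y = c * riesz q y" for c and q :: "'a mpoly"
    by (subst riesz_mult[of "{0}" _ "Poly_Mapping.keys q"])
      (auto simp: riesz_def sum_distrib_left mult_ac)
  ultimately show ?thesis by (simp add: riesz_sum riesz_def[of p])
qed

lemma riesz_le_peval:
  fixes p :: "'n::finite mpoly"
  assumes "sos_concave p" "deg_le p (2 * d)"
    and psd: "\<And>q. deg_le q d \<Longrightarrow> 0 \<le> riesz (q * q) y"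
    and "y 0 = 1" and u: "\<And>i. u $ i = y (Poly_Mapping.single i 1)"
  shows "riesz p y \<le> peval p u"
proof -
  \<comment> \<open>The moments of \<open>y\<close> centred at \<open>u\<close>; by
    \<open>riesz_shift\<close> they represent the functional
    \<open>riesz (shift (- u) q) y\<close>.\<close>
  define z where "z \<alpha> = riesz (shift (- u) (monomial \<alpha>)) y" for \<alpha>
  have riesz_z: "riesz q z = riesz (shift (- u) q) y" for q
    unfolding z_def by (rule riesz_shift[symmetric])
  have "shift (- u) (monomial 0) = const 1"
    by (rule mpoly_eqI) (simp add: monomial_def)
  then have z0: "z 0 = 1" using assms(4) unfolding z_def by (simp only: riesz_single mult_1)
  have "shift (- u) (var i) = var i + const (- (u $ i))" for i
    by (rule mpoly_eqI) (simp add: peval_add)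
  \<comment> \<open>The centred first moment is \<open>y\<close> at the unit vector minus
    \<open>u $ i * y 0\<close>, which is 0 because \<open>y 0 = 1\<close>.\<close>
  then have z1: "z (Poly_Mapping.single i 1) = 0" for i
    unfolding z_def by (simp add: riesz_add riesz_single monomial_def u assms(4))
  have "riesz (shift u p) z \<le> Poly_Mapping.lookup (shift u p) 0 * z 0"
  proof (rule riesz_le_at_0)
    \<comment> \<open>Translation turns a square into a square and keeps the degree bound.\<close>
    show "0 \<le> riesz (q * q) z" if "deg_le q d" for q
      unfolding riesz_z shift_mult using that by (intro psd deg_le_shift)
  qed (use z1 assms(1,2) in \<open>simp_all add: sos_concave_shift deg_le_shift\<close>)
  then show ?thesis
    by (simp add: riesz_z shift_shift z0 peval_at_0[symmetric])
qed

subsection \<open>The lifted representation\<close>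

text \<open>The value is the quadratic form of the moment matrix at the coefficient vector of
  \<open>p\<close>.\<close>

lemma riesz_square_nonneg_if_psd:
  assumes "psd_on (expos_upto d) (moment_matrix d y)" "deg_le p d"
  shows "0 \<le> riesz (p * p) y"
proof -
  have "riesz (p * p) y = (\<Sum>\<beta>\<in>expos_upto d. \<Sum>\<gamma>\<in>expos_upto d.
      Poly_Mapping.lookup p \<beta> * moment_matrix d y \<beta> \<gamma> * Poly_Mapping.lookup p \<gamma>)"
    by (simp add: riesz_mult[OF finite_expos_upto assms(2) finite_expos_upto assms(2)]
        moment_matrix_entry mult_ac)
  with assms(1) show ?thesis by (simp add: psd_on_def)
qed

text \<open>The moment matrix of a point is the rank-one matrix formed from its vector of
  monomials.\<close>

lemma psd_on_mono_eval: "psd_on (expos_upto d) (moment_matrix d (mono_eval x))"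
proof -
  have "(\<Sum>a\<in>expos_upto d. \<Sum>b\<in>expos_upto d. v a * moment_matrix d (mono_eval x) a b * v b) =
      (\<Sum>a\<in>expos_upto d. v a * mono_eval x a)\<^sup>2" for v
    by (simp add: moment_matrix_entry mono_eval_add power2_eq_square sum_product mult_ac)
  then show ?thesis by (simp add: psd_on_def moment_matrix_entry add.commute)
qed

lemma deg_le_half_degree:
  assumes "i \<in> {1..m}"
  shows "deg_le (g i) (2 * half_degree m g)"
proof (rule pdeg_le_imp_deg_le)
  have "nat \<lceil>real (pdeg (g i)) / 2\<rceil> \<le> half_degree m g"
    unfolding half_degree_def using assms by (intro Max_ge) auto
  then show "pdeg (g i) \<le> 2 * half_degree m g" by linarith
qed

theorem theorem9:
  fixes g :: "nat \<Rightarrow> 'n::finite mpoly" and m :: nat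
  assumes "1 \<le> m"
    and "interior (semialg_set m g) \<noteq> {}"
    and "\<And>i. i \<in> {1..m} \<Longrightarrow> sos_concave (g i)"
  shows "semialg_set m g =
    {x. \<exists>y\<in>lifted_set m g. \<forall>i. x $ i = y (Poly_Mapping.single i 1)}"
proof (intro equalityI subsetI)
  fix x assume "x \<in> semialg_set m g"
  then have "mono_eval x \<in> lifted_set m g"
    by (simp add: semialg_set_def lifted_set_def psd_on_mono_eval peval_eq_riesz)
  then show "x \<in> {x. \<exists>y\<in>lifted_set m g. \<forall>i. x $ i = y (Poly_Mapping.single i 1)}"
    using mono_eval_single[of x] by (auto intro!: bexI[of _ "mono_eval x"])
next
  fix x assume "x \<in> {x. \<exists>y\<in>lifted_set m g. \<forall>i. x $ i = y (Poly_Mapping.single i 1)}"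
  then obtain y where y: "y \<in> lifted_set m g" "\<And>i. x $ i = y (Poly_Mapping.single i 1)" by blast
  \<comment> \<open>Jensen's inequality at the first moments \<open>x\<close> carries nonnegativity
    from the Riesz value to \<open>g i\<close> at \<open>x\<close>.\<close>
  have "riesz (g i) y \<le> peval (g i) x" if "i \<in> {1..m}" for i
    using y(1) by (intro riesz_le_peval[OF assms(3)[OF that] deg_le_half_degree[where g = g, OF that]])
      (auto simp: lifted_set_def y(2) intro: riesz_square_nonneg_if_psd)
  then show "x \<in> semialg_set m g"
    using y(1) by (force simp: semialg_set_def lifted_set_def)
qed

end
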